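(* Let $A\subseteq \mathbb{R}^m$, let $a\in A$ and let $V\subseteq \mathbb{R}^m$ be a linear subspace. Let $L\in \mathcal{L}(V,\mathbb{R}^n)$ be a tangential derivative of $f\colon A \to \mathbb{R}^n$ at $a$ with respect to $V$, and let $K \in \mathcal{L}(L[V],\mathbb{R}^p)$ be a tangential derivative of $g\colon f(A) \to \mathbb{R}^p$ at $f(a)$ with respect to $L[V]$. If the function $g$ is Lipschitz continuous, then $K \circ L\in \mathcal{L}(V,\mathbb{R}^p)$ is a tangential derivative of $g\circ f$ at $a$ with respect to $V$.
   Context: $\mathcal{L}(V,\mathbb{R}^n)$ is the space of linear maps from $V$ to $\mathbb{R}^n$, and $L[V]$ is the image of $V$ under $L$. A function $g\colon f(A)\to\mathbb{R}^p$ is Lipschitz continuous if there is $\kappa\ge 0$ such that $\lVert g(y)-g(z)\rVert\le\kappa\lVert y-z\rVert$ for all $y,z\in f(A)$. Tangential derivative: let $A\subseteq\mathbb{R}^m$, $a\in A$, $f\colon A\to\mathbb{R}^n$, and let $V\subseteq\mathbb{R}^m$ be a linear subspace. A linear map $L\in\mathcal{L}(V,\mathbb{R}^n)$ is a tangential derivative of $f$ at $a$ with respect to $V$ if for every $\varepsilon>0$ there exist $\delta>0$ and $\theta>0$ such that if $x\in A$, $v\in V$, $\lVert x-a\rVert\le\delta$ and $\lVert x-a-v\rVert\le\theta\lVert x-a\rVert$, then $\lVert f(x)-f(a)-L[v]\rVert\le\varepsilon\lVert x-a\rVert$. (The same definition is applied to $g$ with domain $f(A)\subseteq\mathbb{R}^n$,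 point $f(a)$ and subspace $L[V]$.) *)

theory Defs
  imports "HOL-Analysis.Analysis"
begin

text \<open>
  A partial function on a set is represented by a total function of which only the values
  on that set matter. In particular a linear map from a subspace \<open>V\<close> is a function that is
  linear on \<open>V\<close> and arbitrary elsewhere.
\<close>

definition linear_map_on ::
    "'a::real_vector set \<Rightarrow> ('a \<Rightarrow> 'b::real_vector) \<Rightarrow> bool" where
  "linear_map_on V L \<longleftrightarrow>
     (\<forall>u\<in>V. \<forall>v\<in>V. L (u + v) = L u + L v) \<and>
     (\<forall>c. \<forall>v\<in>V. L (c *\<^sub>R v) = c *\<^sub>R L v)"

definition tangential_derivative ::
    "('a::real_normed_vector \<Rightarrow> 'b::real_normed_vector) \<Rightarrow> 'a set \<Rightarrow> 'a \<Rightarrow> 'a set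
      \<Rightarrow> ('a \<Rightarrow> 'b) \<Rightarrow> bool" where
  "tangential_derivative f A a V L \<longleftrightarrow>
     linear_map_on V L \<and>
     (\<forall>\<epsilon>>0. \<exists>\<delta>>0. \<exists>\<theta>>0. \<forall>x\<in>A. \<forall>v\<in>V.
        norm (x - a) \<le> \<delta> \<and> norm (x - a - v) \<le> \<theta> * norm (x - a) \<longrightarrow>
        norm (f x - f a - L v) \<le> \<epsilon> * norm (x - a))"

end

theory Submission
  imports Defs
begin

text \<open>Write r for |x - a|, where v in V is a direction close to x - a. The chain rule is
  immediate when \<open>L v\<close> approximates f x - f a to within a small multiple of |f x - f
  a|, for then \<open>K\<close> applies at f x in direction \<open>L v\<close>. But \<open>L\<close>
  controls the error only relative to r, so this can fail when |f x - f a| is much smaller than r.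
  In that case \<open>L v\<close> is small too, hence so is \<open>K (L v)\<close>, and the
  Lipschitz bound makes g (f x) - g (f a) small: no approximation by \<open>K\<close> is needed. A
  threshold \<eta> r separates the two cases. Both rest on linear maps on finite-dimensional
  subspaces being bounded (\<open>linear_map_on_bounded\<close>).\<close>

lemma linear_map_on_extend:
  fixes V :: "'a::real_vector set" and L :: "'a \<Rightarrow> 'b::real_vector"
  assumes "subspace V" "linear_map_on V L"
  obtains L' where "linear L'" "\<And>v. v \<in> V \<Longrightarrow> L' v = L v"
proof -
  obtain B where B: "B \<subseteq> V" "independent B" "V \<subseteq> span B"
    using maximal_independent_subset by blast
  obtain L' where L': "linear L'" "\<forall>x\<in>B. L' x = L x"
    using linear_independent_extend[OF B(2)] by blast
  have L0: "L 0 = 0"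
    using assms unfolding linear_map_on_def
    by (metis add_cancel_right_right subspace_0)
  \<comment> \<open>The set of agreement is a subspace containing the spanning set \<open>B\<close>,
    hence all of V.\<close>
  have "subspace {v \<in> V. L' v = L v}"
    using assms L'(1) L0
    by (auto simp: subspace_def linear_map_on_def linear_0 linear_add linear_scale)
  moreover have "B \<subseteq> {v \<in> V. L' v = L v}"
    using B L' by auto
  ultimately have "span B \<subseteq> {v \<in> V. L' v = L v}"
    by (rule span_minimal[rotated])
  with B(3) L'(1) that show thesis by blast
qed

text \<open>Boundedness is inherited from a linear extension to the whole space, which is
  finite-dimensional.\<close>

lemma linear_map_on_bounded:
  fixes V :: "'a::euclidean_space set" and L :: "'a \<Rightarrow> 'b::real_normed_vector"
  assumes "subspace V" "linear_map_on V L"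
  obtains M where "M > 0" "\<And>v. v \<in> V \<Longrightarrow> norm (L v) \<le> M * norm v"
proof -
  obtain L' where L': "linear L'" "\<And>v. v \<in> V \<Longrightarrow> L' v = L v"
    using linear_map_on_extend[OF assms] by blast
  obtain M where "M > 0" "\<And>v. norm (L' v) \<le> M * norm v"
    using linear_bounded_pos[OF L'(1)] by blast
  with L'(2) that show thesis by metis
qed

lemma subspace_linear_map_on_image:
  assumes "subspace V" "linear_map_on V L"
  shows "subspace (L ` V)"
proof -
  obtain L' where "linear L'" "\<And>v. v \<in> V \<Longrightarrow> L' v = L v"
    using linear_map_on_extend[OF assms] by blast
  then show ?thesis
    using linear_subspace_image[OF _ assms(1)] by (metis image_cong)
qed

lemma linear_map_on_compose:
  assumes "linear_map_on V L" "linear_map_on (L ` V) K"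
  shows "linear_map_on V (K \<circ> L)"
  using assms by (simp add: linear_map_on_def)

lemma tangential_derivativeD:
  assumes "tangential_derivative f A a V L" "\<epsilon> > 0"
  obtains \<delta> \<theta> where "\<delta> > 0" "\<theta> > 0"
    "\<And>x v. \<lbrakk>x \<in> A; v \<in> V; norm (x - a) \<le> \<delta>; norm (x - a - v) \<le> \<theta> * norm (x - a)\<rbrakk> \<Longrightarrow>
      norm (f x - f a - L v) \<le> \<epsilon> * norm (x - a)"
proof -
  from assms obtain \<delta> \<theta> where "\<delta> > 0" "\<theta> > 0"
    "\<forall>x\<in>A. \<forall>v\<in>V. norm (x - a) \<le> \<delta> \<and> norm (x - a - v) \<le> \<theta> * norm (x - a) \<longrightarrow>
      norm (f x - f a - L v) \<le> \<epsilon> * norm (x - a)"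
    unfolding tangential_derivative_def by blast
  then show thesis by (intro that[of \<delta> \<theta>]) auto
qed

lemma tangential_derivative_compose:
  fixes A V :: "'a::euclidean_space set"
    and f L :: "'a \<Rightarrow> 'b::euclidean_space"
    and g K :: "'b \<Rightarrow> 'c::real_normed_vector"
  assumes a: "a \<in> A"
    and V: "subspace V"
    and f: "tangential_derivative f A a V L"
    and g: "tangential_derivative g (f ` A) (f a) (L ` V) K"
    and lip: "\<kappa>-lipschitz_on (f ` A) g"
  shows "tangential_derivative (g \<circ> f) A a V (K \<circ> L)"
  unfolding tangential_derivative_def
proof (intro conjI allI impI)
  have linL: "linear_map_on V L" and linK: "linear_map_on (L ` V) K"
    using f g by (auto simp: tangential_derivative_def)
  then show "linear_map_on V (K \<circ> L)"
    by (rule linear_map_on_compose)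
  obtain M where M: "M > 0" "\<And>v. v \<in> V \<Longrightarrow> norm (L v) \<le> M * norm v"
    using linear_map_on_bounded[OF V linL] by blast
  obtain N where N: "N > 0" "\<And>w. w \<in> L ` V \<Longrightarrow> norm (K w) \<le> N * norm w"
    using linear_map_on_bounded[OF subspace_linear_map_on_image[OF V linL] linK] by blast
  have \<kappa>: "\<kappa> \<ge> 0"
    using lip by (rule lipschitz_on_nonneg)
  fix \<epsilon> :: real
  assume \<epsilon>: "\<epsilon> > 0"
  \<comment> \<open>C will bound |f x - f a| / r: the 1 covers the error of \<open>L v\<close>, and
    2M covers \<open>L v\<close> itself, since |v| \<le> 2r. Asking g for accuracy \<epsilon>/C then
    compensates for it.\<close>
  define C where "C = 1 + 2 * M"
  have C: "C > 0"
    using M by (simp add: C_def)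
  obtain \<delta>2 \<theta>2 where \<delta>2: "\<delta>2 > 0" and \<theta>2: "\<theta>2 > 0" and
    g_bound: "\<And>y w. \<lbrakk>y \<in> f ` A; w \<in> L ` V; norm (y - f a) \<le> \<delta>2;
        norm (y - f a - w) \<le> \<theta>2 * norm (y - f a)\<rbrakk> \<Longrightarrow>
        norm (g y - g (f a) - K w) \<le> \<epsilon> / C * norm (y - f a)"
    using tangential_derivativeD[OF g divide_pos_pos[OF \<epsilon> C]] by blast
  \<comment> \<open>The threshold is such that the Lipschitz part \<kappa>\<eta> and the part
    2N\<eta> from \<open>K (L v)\<close> add up to \<epsilon>.\<close>
  define \<eta> where "\<eta> = \<epsilon> / (\<kappa> + 2 * N)"
  have pos_denom: "\<kappa> + 2 * N > 0"
    using \<kappa> N(1) by simp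
  then have \<eta>: "\<eta> > 0"
    using \<epsilon> by (simp add: \<eta>_def)
  have "\<eta> * (\<kappa> + 2 * N) = \<epsilon>"
    using pos_denom by (simp add: \<eta>_def)
  then have \<eta>_eq: "\<kappa> * \<eta> + N * (2 * \<eta>) = \<epsilon>"
    by (simp add: algebra_simps)
  \<comment> \<open>The bound 1 gives the constant C, \<eta> keeps \<open>L v\<close> below 2\<eta>r
    in the small case, and \<theta>2\<eta> makes \<open>L v\<close> admissible for g in the
    other.\<close>
  define \<epsilon>1 where "\<epsilon>1 = min 1 (min \<eta> (\<theta>2 * \<eta>))"
  have \<epsilon>1: "\<epsilon>1 > 0" "\<epsilon>1 \<le> 1" "\<epsilon>1 \<le> \<eta>" "\<epsilon>1 \<le> \<theta>2 * \<eta>"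
    using \<eta> \<theta>2 by (auto simp: \<epsilon>1_def)
  obtain \<delta>1 \<theta>1 where \<delta>1: "\<delta>1 > 0" and \<theta>1: "\<theta>1 > 0" and
    f_bound: "\<And>x v. \<lbrakk>x \<in> A; v \<in> V; norm (x - a) \<le> \<delta>1;
        norm (x - a - v) \<le> \<theta>1 * norm (x - a)\<rbrakk> \<Longrightarrow>
        norm (f x - f a - L v) \<le> \<epsilon>1 * norm (x - a)"
    using tangential_derivativeD[OF f \<epsilon>1(1)] by blast
  \<comment> \<open>The cap \<delta>2/C keeps f x within \<delta>2 of f a; the cap 1 on \<theta>
    yields |v| \<le> 2r.\<close>
  define \<delta> \<theta> where "\<delta> = min \<delta>1 (\<delta>2 / C)" and "\<theta> = min \<theta>1 1"
  have pos: "\<delta> > 0" "\<theta> > 0"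
    using \<delta>1 \<delta>2 \<theta>1 C by (auto simp: \<delta>_def \<theta>_def)
  have "norm ((g \<circ> f) x - (g \<circ> f) a - (K \<circ> L) v) \<le> \<epsilon> * norm (x - a)"
    if xv: "x \<in> A" "v \<in> V" and d: "norm (x - a) \<le> \<delta>"
      and t: "norm (x - a - v) \<le> \<theta> * norm (x - a)" for x v
  proof -
    define r where "r = norm (x - a)"
    have r: "0 \<le> r" "r \<le> \<delta>1" "C * r \<le> \<delta>2"
      using d C by (auto simp: r_def \<delta>_def field_simps)
    have t': "norm (x - a - v) \<le> \<theta>1 * r" "norm (x - a - v) \<le> r"
      using t mult_right_mono[of \<theta> \<theta>1 r] mult_right_mono[of \<theta> 1 r] r(1)
      by (auto simp: r_def \<theta>_def)
    have fx: "norm (f x - f a - L v) \<le> \<epsilon>1 * r"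
      using f_bound[OF xv] r(2) t'(1) by (simp add: r_def)
    show ?thesis
    \<comment> \<open>If \<open>f x - f a\<close> is not small compared with \<open>x - a\<close>, the direction \<open>L v\<close> is admissible
      for \<open>g\<close>; otherwise \<open>L v\<close> is small as well and the Lipschitz bound suffices.\<close>
    proof (cases "norm (f x - f a) \<le> \<eta> * r")
      case True
      have "norm (L v) \<le> norm (f x - f a) + norm (f x - f a - L v)"
        by norm
      also have "\<dots> \<le> 2 * \<eta> * r"
        using True fx mult_right_mono[OF \<epsilon>1(3) r(1)] by linarith
      finally have "norm (K (L v)) \<le> N * (2 * \<eta> * r)"
        using order_trans[OF N(2)[OF imageI[OF xv(2)]] mult_left_mono] N(1) by simp
      moreover have "norm (g (f x) - g (f a)) \<le> \<kappa> * norm (f x - f a)"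
        using lipschitz_onD[OF lip, of "f x" "f a"] xv(1) a by (simp add: dist_norm)
      with mult_left_mono[OF True \<kappa>] have "norm (g (f x) - g (f a)) \<le> \<kappa> * (\<eta> * r)"
        by linarith
      ultimately have "norm (g (f x) - g (f a) - K (L v)) \<le> \<kappa> * (\<eta> * r) + N * (2 * \<eta> * r)"
        using norm_triangle_ineq4[of "g (f x) - g (f a)" "K (L v)"] by linarith
      also have "\<dots> = \<epsilon> * r"
        by (simp add: \<eta>_eq[symmetric] algebra_simps)
      finally show ?thesis by (simp add: r_def)
    next
      case False
      \<comment> \<open>Here \<eta>r < |f x - f a|, which turns the error relative to r into one
        relative to |f x - f a|, as the condition on g demands.\<close>
      have "\<epsilon>1 * r \<le> \<theta>2 * (\<eta> * r)"
        using mult_right_mono[OF \<epsilon>1(4) r(1)] by (simp add: mult.assoc)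
      also have "\<dots> \<le> \<theta>2 * norm (f x - f a)"
        using False \<theta>2 by simp
      finally have dir: "norm (f x - f a - L v) \<le> \<theta>2 * norm (f x - f a)"
        using fx by linarith
      have "norm v \<le> norm (x - a) + norm (x - a - v)"
        by norm
      then have "norm v \<le> 2 * r"
        using t'(2) by (simp add: r_def)
      then have "norm (L v) \<le> M * (2 * r)"
        using M(2)[OF xv(2)] mult_left_mono[of "norm v" "2 * r" M] M(1) by linarith
      moreover have "norm (f x - f a) \<le> norm (f x - f a - L v) + norm (L v)"
        by norm
      moreover have "\<epsilon>1 * r \<le> r"
        using mult_right_mono[OF \<epsilon>1(2) r(1)] by simp
      ultimately have fC: "norm (f x - f a) \<le> C * r"
        using fx by (simp add: C_def algebra_simps)
      have "norm (g (f x) - g (f a) - K (L v)) \<le> \<epsilon> / C * norm (f x - f a)"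
        using g_bound[of "f x" "L v"] xv dir fC r(3) by simp
      also have "\<dots> \<le> \<epsilon> / C * (C * r)"
        using mult_left_mono[OF fC, of "\<epsilon> / C"] \<epsilon> C by simp
      finally show ?thesis using C by (simp add: r_def)
    qed
  qed
  then show "\<exists>\<delta>>0. \<exists>\<theta>>0. \<forall>x\<in>A. \<forall>v\<in>V.
      norm (x - a) \<le> \<delta> \<and> norm (x - a - v) \<le> \<theta> * norm (x - a) \<longrightarrow>
      norm ((g \<circ> f) x - (g \<circ> f) a - (K \<circ> L) v) \<le> \<epsilon> * norm (x - a)"
    using pos by blast
qed

theorem corollary3p2:
  fixes A V :: "(real ^ 'm) set"
    and a :: "real ^ 'm"
    and f L :: "real ^ 'm \<Rightarrow> real ^ 'n"
    and g K :: "real ^ 'n \<Rightarrow> real ^ 'p"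
  assumes "a \<in> A"
    and "subspace V"
    and "tangential_derivative f A a V L"
    and "tangential_derivative g (f ` A) (f a) (L ` V) K"
    and "\<exists>\<kappa>. \<kappa>-lipschitz_on (f ` A) g"
  shows "tangential_derivative (g \<circ> f) A a V (K \<circ> L)"
  using assms tangential_derivative_compose by blast

end
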